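(* For any fixed integer $k\ge 4$, as $n\to\infty$, $$f_k(n,k+2,3)=e^{O\left(\sqrt{\log_{(k-1)} n}\right)}=(\log_{(k-2)} n)^{o(1)}.$$
   Context: $K_n^{(k)}$ denotes the complete $k$-uniform hypergraph on $n$ vertices. For positive integers $p,q$, a $(p,q)$-coloring of $K_n^{(k)}$ is an edge-coloring of $K_n^{(k)}$ in which every copy of $K_p^{(k)}$ (i.e. the set of all $k$-subsets of any $p$ vertices) receives at least $q$ distinct colors. $f_k(n,p,q)$ is the minimum number of colors in a $(p,q)$-coloring of $K_n^{(k)}$. Iterated logarithms: $\log_{(0)}x=x$ and $\log_{(i+1)}x=\log\log_{(i)}x$ for $i\ge 0$. The asymptotic notation is for $k$ fixed and $n\to\infty$ (implied constants may depend on $k$); the first equality is an upper bound: there is a constant $C=C(k)$ with $f_k(n,k+2,3)\le e^{C\sqrt{\log_{(k-1)}n}}$ for all sufficiently large $n$. *)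

theory Defs
  imports Complex_Main "HOL-Library.Ramsey" "HOL-Library.Landau_Symbols"
begin

text \<open>The complete \<open>k\<close>-uniform hypergraph on a finite vertex set \<open>V\<close> has edge set \<^term>\<open>nsets V k\<close>;
  \<open>K_n^(k)\<close> is taken on \<^term>\<open>{..<n}\<close>. Only the values of a coloring \<open>c\<close> on edges matter.\<close>

definition pq_coloring :: "nat \<Rightarrow> nat \<Rightarrow> nat \<Rightarrow> nat \<Rightarrow> (nat set \<Rightarrow> nat) \<Rightarrow> bool" where
  "pq_coloring k n p q c \<longleftrightarrow> (\<forall>S \<in> nsets {..<n} p. card (c ` nsets S k) \<ge> q)"

text \<open>The set of admissible numbers of colors is nonempty whenever \<^term>\<open>q \<le> p choose k\<close>
  (see below), in particular for \<^term>\<open>p = k + 2\<close>, \<^term>\<open>q = 3\<close> and \<^term>\<open>k \<ge> 1\<close>; otherwise the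
  value may be unspecified.\<close>

definition f_EG :: "nat \<Rightarrow> nat \<Rightarrow> nat \<Rightarrow> nat \<Rightarrow> nat" where
  "f_EG k n p q = (LEAST r. \<exists>c. pq_coloring k n p q c \<and> c ` nsets {..<n} k \<subseteq> {..<r})"

lemma ex_pq_coloring:
  assumes "q \<le> p choose k"
  shows "\<exists>r c. pq_coloring k n p q c \<and> c ` nsets {..<n} k \<subseteq> {..<r}"
proof -
  have "finite (nsets {..<n} k)"
    by (simp add: finite_imp_finite_nsets)
  then obtain c :: "nat set \<Rightarrow> nat" and r where c: "c ` nsets {..<n} k = {..<r}" "inj_on c (nsets {..<n} k)"
    using finite_imp_inj_to_nat_seg[of "nsets {..<n} k"] by (auto simp: lessThan_def)
  have "card (c ` nsets S k) \<ge> q" if "S \<in> nsets {..<n} p" for S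
  proof -
    have S: "S \<subseteq> {..<n}" "finite S" "card S = p"
      using that by (auto simp: nsets_def)
    have "inj_on c (nsets S k)"
      by (rule inj_on_subset[OF c(2) nsets_mono[OF S(1)]])
    then show ?thesis
      using S assms by (simp add: card_image)
  qed
  then show ?thesis
    using c(1) unfolding pq_coloring_def by blast
qed

text \<open>Natural logarithm; for small \<open>x\<close> the iterates are junk values, but it is only used
  for large \<open>x\<close>.\<close>

definition iter_ln :: "nat \<Rightarrow> real \<Rightarrow> real" where
  "iter_ln i x = (ln ^^ i) x"

end

theory Submission
  imports Defs "HOL-Library.Sublist" "HOL-Analysis.Harmonic_Numbers" "HOL-Real_Asymp.Real_Asymp"
begin

text \<open>
  A stepping-up argument starting from graphs. For binary vectors, encoded as numbers below
  \<open>2 ^ N\<close>, let \<open>\<delta> x y\<close> be the highest bit in which \<open>x\<close> and \<open>y\<close> differ. A set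
  \<open>x\<^sub>0 < \<dots> < x\<^sub>k\<close> is colored by the order type of the sequence
  \<open>\<delta> x\<^sub>0 x\<^sub>1, \<dots>, \<delta> x\<^sub>k\<^sub>-\<^sub>1 x\<^sub>k\<close> together with the old color of the set of its values. This costs
  only a constant factor in the number of colors, provided that the induction also carries along
  that every \<open>k + 1\<close> vertices see two colors. On \<open>k + 3\<close> vertices compare the order types of the
  three windows of \<open>k\<close> consecutive levels. If two adjacent windows agree, then \<open>k + 1\<close> consecutive
  levels are monotone and the old coloring provides the missing colors. If only the outer two agree,
  the levels go up and down alternately, and their maximum lies near one of the ends; deleting a
  point next to it creates a monotone triple of levels that neither window type has.
  For \<open>k = 2\<close> this last case needs an extra property of the graph coloring.

  The graph coloring is Mubayi's: vertices are words of length \<open>t\<close> over an alphabet of size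
  \<open>2 ^ t\<close>, and an edge records the first position where its ends differ, the two letters
  there, and the set of all positions where they differ. It has at most \<open>2 ^ (4 * t)\<close> colors on
  \<open>2 ^ (t * t)\<close> vertices.
\<close>

subsection \<open>Level sequences of lists of vertices\<close>

lemma subseq_rev: "subseq xs ys \<Longrightarrow> subseq (rev xs) (rev ys)"
  by (induction rule: list_emb.induct) (auto intro: list_emb_append_mono subseq_rev_drop_many)

lemma subseq_take: "subseq (take n xs) xs"
  by (simp add: prefix_imp_subseq take_is_prefix)

lemma subseq_drop: "subseq (drop n xs) xs"
  by (simp add: suffix_imp_subseq suffix_drop)

text \<open>For \<open>x \<noteq> y\<close> the least number of shifts making them equal is positive, so nothing is truncated;
  \<open>split_level x x = 0\<close> is a junk value.\<close>

definition split_level :: "nat \<Rightarrow> nat \<Rightarrow> nat" where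
  "split_level x y = (LEAST i. x div 2 ^ i = y div 2 ^ i) - 1"

definition levels :: "nat list \<Rightarrow> nat list" where
  "levels xs = map2 split_level xs (tl xs)"

text \<open>What remains of the order of the vertices once they are listed increasingly. Unlike
  sortedness, this survives reversal, so increasing levels reduce to decreasing ones.\<close>

definition ultra :: "nat list \<Rightarrow> bool" where
  "ultra xs \<longleftrightarrow> (\<forall>x y z. subseq [x, y, z] xs \<longrightarrow>
     split_level x z = max (split_level x y) (split_level y z) \<and> split_level x y \<noteq> split_level y z)"

text \<open>As a relation on the indices below \<open>k\<close> it takes at most
  \<open>2 ^ (k * k)\<close> values; a tie shows as the absence of both pairs.\<close>

definition order_type :: "nat \<Rightarrow> nat list \<Rightarrow> (nat \<times> nat) set" where
  "order_type k ds = {(i, j). i < k \<and> j < k \<and> ds ! i < ds ! j}"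

definition list_color :: "nat \<Rightarrow> (nat set \<Rightarrow> nat) \<Rightarrow> nat list \<Rightarrow> (nat \<times> nat) set \<times> nat" where
  "list_color k \<phi> xs = (order_type k (levels xs), \<phi> (set (levels xs)))"

definition list_colors :: "nat \<Rightarrow> (nat set \<Rightarrow> nat) \<Rightarrow> nat list \<Rightarrow> ((nat \<times> nat) set \<times> nat) set" where
  "list_colors k \<phi> xs = list_color k \<phi> ` {ys. subseq ys xs \<and> length ys = Suc k}"

lemma split_level_commute: "split_level x y = split_level y x"
  by (simp add: split_level_def eq_commute)

lemma levels_simps [simp]:
  "levels [] = []" "levels [x] = []" "levels (x # y # zs) = split_level x y # levels (y # zs)"
  by (simp_all add: levels_def)

lemma length_levels [simp]: "length (levels xs) = length xs - 1"
  by (simp add: levels_def)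

lemma nth_levels: "Suc i < length xs \<Longrightarrow> levels xs ! i = split_level (xs ! i) (xs ! Suc i)"
  by (simp add: levels_def nth_tl)

lemma levels_take: "levels (take (Suc n) xs) = take n (levels xs)"
  by (rule nth_equalityI) (auto simp: nth_levels less_diff_conv)

lemma levels_drop: "levels (drop n xs) = drop n (levels xs)"
  by (rule nth_equalityI) (auto simp: nth_levels)

lemma levels_rev: "levels (rev xs) = rev (levels xs)"
proof (rule nth_equalityI)
  fix i assume "i < length (levels (rev xs))"
  then show "levels (rev xs) ! i = rev (levels xs) ! i"
    by (auto simp: nth_levels rev_nth Suc_diff_Suc split_level_commute)
qed simp

lemma ultra_subseq: "ultra xs \<Longrightarrow> subseq ys xs \<Longrightarrow> ultra ys"
  unfolding ultra_def by (meson subseq_order.trans)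

lemma ultra_rev: "ultra xs \<Longrightarrow> ultra (rev xs)"
  unfolding ultra_def
  by (metis max.commute rev.simps rev_rev_ident append_Cons append_Nil split_level_commute subseq_rev)

lemma subseq_consecutive:
  assumes "Suc (Suc i) < length xs"
  shows "subseq [xs ! i, xs ! Suc i, xs ! Suc (Suc i)] xs"
proof -
  have "drop i xs = xs ! i # xs ! Suc i # xs ! Suc (Suc i) # drop (Suc (Suc (Suc i))) xs"
    using assms by (simp add: Cons_nth_drop_Suc)
  then have "subseq [xs ! i, xs ! Suc i, xs ! Suc (Suc i)] (drop i xs)"
    by simp
  then show ?thesis
    using subseq_drop subseq_order.trans by blast
qed

lemma ultra_levels_neq:
  assumes "ultra xs" "Suc (Suc i) < length xs"
  shows "levels xs ! i \<noteq> levels xs ! Suc i"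
  using assms subseq_consecutive[OF assms(2)] by (simp add: ultra_def nth_levels)

lemma ultra_split_level_two:
  assumes "ultra xs" "Suc (Suc i) < length xs"
  shows "split_level (xs ! i) (xs ! Suc (Suc i)) = max (levels xs ! i) (levels xs ! Suc i)"
  using assms subseq_consecutive[OF assms(2)] by (simp add: ultra_def nth_levels)

lemma finite_list_colors [simp]: "finite (list_colors k \<phi> xs)"
proof -
  have "finite {ys. subseq ys xs}"
    by (metis List.finite_set set_subseqs_eq)
  then show ?thesis
    by (auto simp: list_colors_def)
qed

lemma list_colors_mono: "subseq ys xs \<Longrightarrow> list_colors k \<phi> ys \<subseteq> list_colors k \<phi> xs"
  unfolding list_colors_def by (blast intro: subseq_order.trans)

lemma list_colorsI:
  "subseq ys xs \<Longrightarrow> length ys = Suc k \<Longrightarrow> (order_type k (levels ys), \<phi> (set (levels ys))) \<in> list_colors k \<phi> xs"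
  unfolding list_colors_def list_color_def by blast

lemma order_type_rev:
  assumes "length ds = k"
  shows "order_type k (rev ds) = (\<lambda>(i, j). (k - Suc i, k - Suc j)) ` order_type k ds"
proof -
  have "(i, j) \<in> (\<lambda>(i, j). (k - Suc i, k - Suc j)) ` order_type k ds"
    if "(i, j) \<in> order_type k (rev ds)" for i j
    using that assms by (intro image_eqI[of _ _ "(k - Suc i, k - Suc j)"]) (auto simp: order_type_def rev_nth)
  then show ?thesis
    using assms by (auto simp: order_type_def rev_nth)
qed

text \<open>Reversal reflects the indices of the order type and keeps the set of levels, so the new
  color is a function \<open>f\<close> of the old one. The resulting inequality is applied to
  \<open>xs\<close> and to \<open>rev xs\<close>.\<close>

lemma card_list_colors_rev: "card (list_colors k \<phi> (rev xs)) = card (list_colors k \<phi> xs)"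
proof -
  define f where "f = (\<lambda>(R, c :: nat). ((\<lambda>(i, j). (k - Suc i, k - Suc j)) ` R, c))"
  have "list_colors k \<phi> (rev xs) \<subseteq> f ` list_colors k \<phi> xs" for xs
  proof (clarsimp simp: list_colors_def image_image)
    fix ys assume ys: "subseq ys (rev xs)" "length ys = Suc k"
    have "list_color k \<phi> ys = f (list_color k \<phi> (rev ys))"
      using ys(2) order_type_rev[of "levels (rev ys)" k]
      by (simp add: list_color_def f_def levels_rev)
    moreover have "subseq (rev ys) xs"
      using subseq_rev[OF ys(1)] by simp
    ultimately show "list_color k \<phi> ys \<in> (\<lambda>x. f (list_color k \<phi> x)) ` {ys. subseq ys xs \<and> length ys = Suc k}"
      using ys(2) by auto
  qed
  then have "card (list_colors k \<phi> (rev xs)) \<le> card (list_colors k \<phi> xs)" for xs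
    by (meson card_image_le card_mono finite_imageI finite_list_colors order_trans)
  from this[of xs] this[of "rev xs"] show ?thesis
    by simp
qed

section \<open>Decreasing level sequences\<close>

lemma split_level_decreasing:
  assumes "ultra (x # y # zs)" "sorted_wrt (>) (levels (x # y # zs))" "w \<in> set (y # zs)"
  shows "split_level x w = split_level x y"
  using assms
proof (induction zs arbitrary: x y)
  case (Cons z zs)
  show ?case
  proof (cases "w = y")
    case False
    have "ultra (y # z # zs)"
      using Cons.prems(1) ultra_subseq by blast
    then have "split_level y w = split_level y z"
      using Cons False by auto
    moreover have "subseq [x, y, w] (x # y # z # zs)"
      using Cons.prems(3) False by (auto simp: subseq_singleton_left)
    \<comment> \<open>By induction \<open>split_level y w\<close> is the second level, so the
      maximum is the first one.\<close>
    then have "split_level x w = max (split_level x y) (split_level y w)"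
      using Cons.prems(1) unfolding ultra_def by blast
    ultimately show ?thesis
      using Cons.prems(2) by simp
  qed simp
qed auto

text \<open>Deleting the first point drops the first level, and deleting an inner point keeps the
  larger, left one of its two levels. So each level can be kept or dropped independently, from the
  front.\<close>

lemma decreasing_levels_realise:
  assumes "ultra xs" "sorted_wrt (>) (levels xs)" "subseq E (levels xs)" "xs \<noteq> []"
  shows "\<exists>ys. subseq ys xs \<and> ys \<noteq> [] \<and> levels ys = E"
  using assms
proof (induction xs arbitrary: E rule: induct_list012)
  case (2 x)
  then show ?case by (intro exI[of _ "[x]"]) (auto dest: list_emb_Nil2)
next
  case (3 x y zs)
  have u: "ultra (y # zs)" "sorted_wrt (>) (levels (y # zs))"
    using "3.prems"(1,2) ultra_subseq by (blast, simp)
  show ?case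
  proof (cases "subseq E (levels (y # zs))")
    case True
    then show ?thesis
      using "3.IH"(2)[OF u True] by (metis list.discI list_emb_Cons)
  next
    case False
    then obtain E' where E: "E = split_level x y # E'" "subseq E' (levels (y # zs))"
      using "3.prems"(3) by (cases E) (auto split: if_splits)
    obtain ys where ys: "subseq ys (y # zs)" "ys \<noteq> []" "levels ys = E'"
      using "3.IH"(2)[OF u E(2)] by auto
    obtain w ws where w: "ys = w # ws"
      using ys(2) by (cases ys) auto
    have "w \<in> set (y # zs)"
      using ys(1) w by (meson list.set_intros(1) subseq_singleton_left subseq_order.trans subseq_Cons2 list_emb_Nil)
    then have "split_level x w = split_level x y"
      using split_level_decreasing "3.prems" by blast
    then show ?thesis
      using E ys w by (intro exI[of _ "x # ys"]) auto
  qed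
qed auto

definition dec_type :: "nat \<Rightarrow> (nat \<times> nat) set" where
  "dec_type k = {(i, j). i < k \<and> j < k \<and> j < i}"

lemma order_type_decreasing:
  assumes "sorted_wrt (>) ds" "length ds = k"
  shows "order_type k ds = dec_type k"
proof -
  have "ds ! i < ds ! j \<longleftrightarrow> j < i" if "i < k" "j < k" for i j
    using that assms sorted_wrt_nth_less[of "(>)" ds i j] sorted_wrt_nth_less[of "(>)" ds j i]
    by (cases i j rule: linorder_cases) auto
  then show ?thesis
    by (auto simp: order_type_def dec_type_def)
qed

text \<open>Every \<open>k\<close>-subset of the levels is the level set of a sublist. All these
  sublists share one order type, so only the old coloring tells them apart.\<close>

lemma list_colors_decreasing:
  assumes "ultra xs" "sorted_wrt (>) (levels xs)" "k > 0"
  shows "{dec_type k} \<times> (\<phi> ` nsets (set (levels xs)) k) \<subseteq> list_colors k \<phi> xs"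
proof clarsimp
  fix D assume D: "D \<in> [set (levels xs)]\<^bsup>k\<^esup>"
  define E where "E = filter (\<lambda>d. d \<in> D) (levels xs)"
  have E: "subseq E (levels xs)" "set E = D" "sorted_wrt (>) E"
    using D assms(2) by (auto simp: E_def nsets_def sorted_wrt_filter)
  have "distinct E"
    using E(3) by (simp add: sorted_wrt_iff_nth_less distinct_conv_nth) (metis linorder_neqE_nat less_irrefl)
  then have len: "length E = k"
    using E(2) D by (auto simp: nsets_def distinct_card[symmetric])
  have "xs \<noteq> []"
    using E(1) len assms(3) by auto
  then obtain ys where ys: "subseq ys xs" "ys \<noteq> []" "levels ys = E"
    using decreasing_levels_realise assms E(1) by blast
  then have "length ys = Suc k"
    using len length_levels[of ys] by (cases ys) auto
  then show "(dec_type k, \<phi> D) \<in> list_colors k \<phi> xs"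
    using list_colorsI[of ys xs k \<phi>] ys order_type_decreasing[OF E(3) len] E(2) by simp
qed

subsection \<open>Two and three colors on a list\<close>

text \<open>The second clause is the goal, the first is carried along for the induction, and the
  third serves alternating sequences of four levels. There \<open>d\<close> may equal
  \<open>a\<close> or \<open>b\<close>, since levels that are not adjacent can repeat.\<close>

definition admissible :: "nat \<Rightarrow> nat set \<Rightarrow> (nat set \<Rightarrow> nat) \<Rightarrow> bool" where
  "admissible k A \<phi> \<longleftrightarrow>
     (\<forall>D \<in> nsets A (k + 1). 2 \<le> card (\<phi> ` nsets D k)) \<and>
     (\<forall>D \<in> nsets A (k + 2). 3 \<le> card (\<phi> ` nsets D k)) \<and>
     (k = 2 \<longrightarrow> (\<forall>a\<in>A. \<forall>b\<in>A. \<forall>c\<in>A. \<forall>d\<in>A. a < b \<and> b < c \<and> d < c \<longrightarrow>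
        \<not> (\<phi> {a, c} = \<phi> {b, c} \<and> \<phi> {a, b} = \<phi> {d, c})))"

lemma three_le_cardI:
  assumes "finite A" "x \<in> A" "y \<in> A" "z \<in> A" "x \<noteq> y" "y \<noteq> z" "x \<noteq> z"
  shows "3 \<le> card A"
  using card_mono[of A "{x, y, z}"] assms by simp

lemma two_le_cardI: "finite A \<Longrightarrow> x \<in> A \<Longrightarrow> y \<in> A \<Longrightarrow> x \<noteq> y \<Longrightarrow> 2 \<le> card A"
  using card_mono[of A "{x, y}"] by simp

lemma two_le_cardE:
  assumes "2 \<le> card A"
  obtains x y where "x \<in> A" "y \<in> A" "x \<noteq> y"
proof -
  obtain x B where "A = insert x B" "x \<notin> B" "Suc 0 \<le> card B"
    using assms card_le_Suc_iff[of "Suc 0" A] by (auto simp: numeral_2_eq_2)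
  then show thesis
    using that by (cases "B = {}") auto
qed

lemma mem_order_type_window:
  "m + k \<le> length ds \<Longrightarrow>
   (i, j) \<in> order_type k (take k (drop m ds)) \<longleftrightarrow> i < k \<and> j < k \<and> ds ! (m + i) < ds ! (m + j)"
  by (auto simp: order_type_def)

lemma list_colors_window:
  assumes "m + k < length xs"
  shows "\<exists>c. (order_type k (take k (drop m (levels xs))), c) \<in> list_colors k \<phi> xs"
proof -
  have "subseq (take (Suc k) (drop m xs)) xs"
    using subseq_drop subseq_take subseq_order.trans by blast
  from list_colorsI[OF this, of k \<phi>] show ?thesis
    using assms by (auto simp: levels_take levels_drop)
qed

lemma sorted_wrt_greater_iff: "sorted_wrt (>) (ds :: nat list) \<longleftrightarrow> (\<forall>i. Suc i < length ds \<longrightarrow> ds ! i > ds ! Suc i)"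
  by (rule sorted_wrt_iff_nth_Suc_transp) (auto simp: transp_def)

lemma sorted_wrt_less_iff: "sorted_wrt (<) (ds :: nat list) \<longleftrightarrow> (\<forall>i. Suc i < length ds \<longrightarrow> ds ! i < ds ! Suc i)"
  by (rule sorted_wrt_iff_nth_Suc_transp) (auto simp: transp_def)

lemma sorted_wrt_greater_rev: "sorted_wrt (>) (rev ds) \<longleftrightarrow> sorted_wrt (<) (ds :: nat list)"
  by (simp add: sorted_wrt_rev)

text \<open>Equal windows say that steps \<open>i\<close> and \<open>i + 1\<close> of the sequence
  go in the same direction, so all \<open>k\<close> steps do.\<close>

lemma monotone_if_windows_eq:
  fixes ds :: "nat list"
  assumes eq: "order_type k (take k ds) = order_type k (take k (drop 1 ds))"
    and len: "length ds = Suc k"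
    and neq: "\<And>i. i < k \<Longrightarrow> ds ! i \<noteq> ds ! Suc i"
  shows "sorted_wrt (>) ds \<or> sorted_wrt (<) ds"
proof -
  have step: "ds ! i < ds ! Suc i \<longleftrightarrow> ds ! Suc i < ds ! Suc (Suc i)" if "Suc i < k" for i
    using mem_order_type_window[of 0 k ds i "Suc i"] mem_order_type_window[of 1 k ds i "Suc i"] that len eq
    by simp
  have all: "ds ! i < ds ! Suc i \<longleftrightarrow> ds ! 0 < ds ! Suc 0" if "i < k" for i
    using that by (induction i) (auto simp: step)
  show ?thesis
  proof (cases "ds ! 0 < ds ! Suc 0")
    case True
    then show ?thesis
      using all len by (simp add: sorted_wrt_less_iff)
  next
    case False
    have "ds ! Suc i < ds ! i" if "i < k" for i
      using all[OF that] neq[OF that] False by simp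
    then show ?thesis
      using len by (simp add: sorted_wrt_greater_iff)
  qed
qed

lemma distinct_sorted_wrt_greater: "sorted_wrt (>) (ds :: nat list) \<Longrightarrow> distinct ds"
  by (induction ds) auto

text \<open>Monotone levels inherit two colors from the old coloring, after a reversal if they
  increase. Otherwise the two windows of \<open>k\<close> levels differ in type.\<close>

lemma two_list_colors:
  assumes adm: "admissible k A \<phi>" and u: "ultra xs" and len: "length xs = k + 2" and k: "k > 0"
    and sub: "set (levels xs) \<subseteq> A"
  shows "2 \<le> card (list_colors k \<phi> xs)"
proof -
  have dec: "2 \<le> card (list_colors k \<phi> xs)"
    if "sorted_wrt (>) (levels xs)" "ultra xs" "length xs = k + 2" "set (levels xs) \<subseteq> A" for xs
  proof -
    have "set (levels xs) \<in> nsets A (k + 1)"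
      using that distinct_card[OF distinct_sorted_wrt_greater[OF that(1)]] by (simp add: nsets_def)
    then have "2 \<le> card ({dec_type k} \<times> \<phi> ` nsets (set (levels xs)) k)"
      using adm by (simp add: admissible_def card_cartesian_product)
    also have "\<dots> \<le> card (list_colors k \<phi> xs)"
      using that k by (intro card_mono list_colors_decreasing) auto
    finally show ?thesis .
  qed
  show ?thesis
  proof (cases "sorted_wrt (>) (levels xs) \<or> sorted_wrt (<) (levels xs)")
    case True
    then show ?thesis
      using dec[of xs] dec[of "rev xs"] u len sub
      by (auto simp: levels_rev card_list_colors_rev ultra_rev sorted_wrt_greater_rev)
  next
    case False
    have "order_type k (take k (drop 0 (levels xs))) \<noteq> order_type k (take k (drop 1 (levels xs)))"
      using monotone_if_windows_eq[of k "levels xs"] False u len by (auto simp: ultra_levels_neq)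
    moreover obtain c where c: "(order_type k (take k (drop 0 (levels xs))), c) \<in> list_colors k \<phi> xs"
      using list_colors_window[of 0 k xs] len by auto
    moreover obtain c' where c': "(order_type k (take k (drop 1 (levels xs))), c') \<in> list_colors k \<phi> xs"
      using list_colors_window[of 1 k xs] len by auto
    ultimately show ?thesis
      using two_le_cardI[OF finite_list_colors c c'] by simp
  qed
qed

text \<open>The decreasing part contributes two colors of type \<open>dec_type k\<close>; any color
  of another type is the third.\<close>

lemma three_list_colors_decreasing_part:
  assumes adm: "admissible k A \<phi>" and u: "ultra xs" and k: "k > 0"
    and ys: "subseq ys xs" "length ys = k + 2" "sorted_wrt (>) (levels ys)" "set (levels ys) \<subseteq> A"
    and R: "(R, c) \<in> list_colors k \<phi> xs" "R \<noteq> dec_type k"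
  shows "3 \<le> card (list_colors k \<phi> xs)"
proof -
  have "set (levels ys) \<in> nsets A (k + 1)"
    using ys distinct_card[OF distinct_sorted_wrt_greater[OF ys(3)]] by (simp add: nsets_def)
  then have "2 \<le> card (\<phi> ` nsets (set (levels ys)) k)"
    using adm by (simp add: admissible_def)
  then obtain a b where ab: "a \<in> \<phi> ` nsets (set (levels ys)) k" "b \<in> \<phi> ` nsets (set (levels ys)) k" "a \<noteq> b"
    by (rule two_le_cardE)
  have "{dec_type k} \<times> (\<phi> ` nsets (set (levels ys)) k) \<subseteq> list_colors k \<phi> xs"
    using list_colors_decreasing[OF ultra_subseq[OF u ys(1)] ys(3) k] list_colors_mono[OF ys(1)] by blast
  then have h: "(dec_type k, a) \<in> list_colors k \<phi> xs" "(dec_type k, b) \<in> list_colors k \<phi> xs"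
    using ab by auto
  show ?thesis
    using three_le_cardI[OF finite_list_colors R(1) h] R(2) ab(3) by simp
qed

lemma three_list_colors_decreasing_window:
  assumes adm: "admissible k A \<phi>" and u: "ultra xs" and k: "k \<ge> 2" and len: "length xs = k + 3"
    and sub: "set (levels xs) \<subseteq> A"
    and dec: "sorted_wrt (>) (take (k + 1) (levels xs)) \<or> sorted_wrt (>) (drop 1 (levels xs))"
  shows "3 \<le> card (list_colors k \<phi> xs)"
proof (cases "sorted_wrt (>) (levels xs)")
  case True
  then have "set (levels xs) \<in> nsets A (k + 2)"
    using distinct_card[OF distinct_sorted_wrt_greater[OF True]] len sub by (simp add: nsets_def)
  then have "3 \<le> card ({dec_type k} \<times> \<phi> ` nsets (set (levels xs)) k)"
    using adm by (simp add: admissible_def card_cartesian_product)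
  also have "\<dots> \<le> card (list_colors k \<phi> xs)"
    using True u k by (intro card_mono list_colors_decreasing) auto
  finally show ?thesis .
next
  case False
  then obtain i where i: "Suc i < k + 2" "\<not> levels xs ! i > levels xs ! Suc i"
    using len by (auto simp: sorted_wrt_greater_iff)
  \<comment> \<open>A window start, at most 2, such that positions \<open>i\<close> and
    \<open>i + 1\<close> both lie in the window of length \<open>k\<close>, which is then not
    decreasing.\<close>
  define m :: nat where "m = min i 2"
  have mi: "m \<le> i" "i - m + 1 < k" "m \<le> 2"
    using i k by (auto simp: m_def)
  have "(Suc (i - m), i - m) \<in> dec_type k"
    using mi by (auto simp: dec_type_def)
  moreover have "(Suc (i - m), i - m) \<notin> order_type k (take k (drop m (levels xs)))"
    using mi i len by (subst mem_order_type_window) (auto simp: Suc_diff_le)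
  ultimately have "order_type k (take k (drop m (levels xs))) \<noteq> dec_type k"
    by blast
  moreover obtain c where "(order_type k (take k (drop m (levels xs))), c) \<in> list_colors k \<phi> xs"
    using list_colors_window[of m k xs] len mi by auto
  moreover obtain ys where "subseq ys xs" "length ys = k + 2" "sorted_wrt (>) (levels ys)" "set (levels ys) \<subseteq> A"
  proof (cases "sorted_wrt (>) (take (k + 1) (levels xs))")
    case True
    have "levels (take (k + 2) xs) = take (k + 1) (levels xs)"
      using levels_take[of "k + 1" xs] by simp
    then show ?thesis
      using that[of "take (k + 2) xs"] True len sub set_take_subset[of "k + 1" "levels xs"]
      by (simp add: subseq_take)
  next
    case False
    then show ?thesis
      using that[of "drop 1 xs"] len sub dec set_drop_subset[of 1 "levels xs"]
      by (simp add: levels_drop subseq_drop)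
  qed
  ultimately show ?thesis
    using three_list_colors_decreasing_part[OF adm u] k by simp
qed

section \<open>Alternating level sequences\<close>

definition zigzag :: "nat list \<Rightarrow> bool" where
  "zigzag ds \<longleftrightarrow> (\<forall>i. Suc (Suc i) < length ds \<longrightarrow>
     ds ! i < ds ! Suc i \<and> ds ! Suc (Suc i) < ds ! Suc i \<or>
     ds ! Suc i < ds ! i \<and> ds ! Suc i < ds ! Suc (Suc i))"

lemma zigzag_rev: "zigzag ds \<Longrightarrow> zigzag (rev ds)"
  unfolding zigzag_def
proof (intro allI impI)
  fix i assume ds: "\<forall>i. Suc (Suc i) < length ds \<longrightarrow>
     ds ! i < ds ! Suc i \<and> ds ! Suc (Suc i) < ds ! Suc i \<or>
     ds ! Suc i < ds ! i \<and> ds ! Suc i < ds ! Suc (Suc i)"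
    and i: "Suc (Suc i) < length (rev ds)"
  define j where "j = length ds - Suc (Suc (Suc i))"
  have "rev ds ! i = ds ! Suc (Suc j)" "rev ds ! Suc i = ds ! Suc j" "rev ds ! Suc (Suc i) = ds ! j"
    "Suc (Suc j) < length ds"
    using i by (auto simp: rev_nth j_def Suc_diff_Suc)
  then show "rev ds ! i < rev ds ! Suc i \<and> rev ds ! Suc (Suc i) < rev ds ! Suc i \<or>
     rev ds ! Suc i < rev ds ! i \<and> rev ds ! Suc i < rev ds ! Suc (Suc i)"
    using ds by auto
qed

lemma zigzag_windows_neq:
  assumes z: "zigzag ds" and len: "length ds = k + 2" and k: "k \<ge> 2"
  shows "order_type k (take k (drop 0 ds)) \<noteq> order_type k (take k (drop 1 ds))"
proof -
  have "(0, 1) \<in> order_type k (take k (drop 0 ds)) \<longleftrightarrow> (0, 1) \<notin> order_type k (take k (drop 1 ds))"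
    using len k z[unfolded zigzag_def, rule_format, of 0]
    by (subst (1 2) mem_order_type_window) (auto simp: numeral_2_eq_2)
  then show ?thesis
    by blast
qed

text \<open>Deleting point \<open>m + 1\<close> merges levels \<open>m\<close> and
  \<open>m + 1\<close> into the maximum, so from point \<open>m\<close> on the levels start with two
  steps that do not go up. An alternating window goes up in one of its first two steps;
  \<open>k \<ge> 3\<close> makes both steps visible.\<close>

lemma three_list_colors_zigzag_max:
  assumes u: "ultra xs" and k: "k \<ge> 3" and len: "length xs = k + 3"
    and z: "zigzag (levels xs)" and m: "m \<le> 1" and max: "\<And>i. i < k + 2 \<Longrightarrow> levels xs ! i \<le> levels xs ! m"
  shows "3 \<le> card (list_colors k \<phi> xs)"
proof -
  define ds where "ds = levels xs"
  have lds: "length ds = k + 2"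
    using len by (simp add: ds_def)
  have g: "ds ! Suc m < ds ! m"
    using ultra_levels_neq[OF u, of m] max[of "Suc m"] k m len by (simp add: ds_def)
  have g2: "ds ! Suc (Suc (Suc m)) < ds ! Suc (Suc m)"
    using z[unfolded zigzag_def, rule_format, of m] z[unfolded zigzag_def, rule_format, of "Suc m"] g k m lds
    by (auto simp: ds_def)
  \<comment> \<open>For \<open>m = 1\<close> exactly \<open>k + 1\<close> points are available and
    for \<open>m = 0\<close> one more; this is where \<open>m \<le> 1\<close> matters.\<close>
  define ys where "ys = take (Suc k) (xs ! m # drop (m + 2) xs)"
  have "drop m xs = xs ! m # xs ! Suc m # drop (m + 2) xs"
    using len k m by (simp add: Cons_nth_drop_Suc)
  then have "subseq (xs ! m # drop (m + 2) xs) (drop m xs)"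
    by (simp add: list_emb_Cons)
  then have ys: "subseq ys xs"
    unfolding ys_def using subseq_take subseq_drop by (meson subseq_order.trans)
  have lys: "length ys = Suc k"
    using len m by (simp add: ys_def)
  have "drop (m + 2) xs = xs ! (m + 2) # drop (m + 3) xs"
    using len k m by (simp add: Cons_nth_drop_Suc numeral_3_eq_3)
  then have "levels (xs ! m # drop (m + 2) xs) = split_level (xs ! m) (xs ! (m + 2)) # levels (drop (m + 2) xs)"
    by simp
  also have "\<dots> = ds ! m # drop (m + 2) ds"
    using ultra_split_level_two[OF u, of m] g len k m by (simp add: levels_drop ds_def)
  finally have lev: "levels ys = take k (ds ! m # drop (m + 2) ds)"
    by (simp only: ys_def levels_take)
  define R where "R = order_type k (levels ys)"
  have R: "(0, 1) \<notin> R" "(1, 2) \<notin> R"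
    using max[of "m + 2"] g2 k m lds by (auto simp: R_def order_type_def lev ds_def)
  have other: "R \<noteq> order_type k (take k (drop j ds))" if "j \<le> 1" for j
  proof -
    have "(0, 1) \<in> order_type k (take k (drop j ds)) \<or> (1, 2) \<in> order_type k (take k (drop j ds))"
      using that lds k z[unfolded zigzag_def, rule_format, of j]
      by (subst (1 2) mem_order_type_window) (auto simp: numeral_2_eq_2 ds_def)
    then show ?thesis
      using R by blast
  qed
  obtain c where c: "(R, c) \<in> list_colors k \<phi> xs"
    using list_colorsI[OF ys lys, of \<phi>] by (auto simp: R_def)
  obtain c0 where c0: "(order_type k (take k (drop 0 ds)), c0) \<in> list_colors k \<phi> xs"
    using list_colors_window[of 0 k xs] len by (auto simp: ds_def)
  obtain c1 where c1: "(order_type k (take k (drop 1 ds)), c1) \<in> list_colors k \<phi> xs"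
    using list_colors_window[of 1 k xs] len by (auto simp: ds_def)
  show ?thesis
    using three_le_cardI[OF finite_list_colors c c0 c1] other[of 0] other[of 1]
      zigzag_windows_neq[of ds k] z lds k by (simp add: ds_def)
qed

lemma order_type_2: "order_type 2 [a, b] = (if a < b then {(0, 1)} else if b < a then {(1, 0)} else {})"
  by (auto simp: order_type_def dest!: less_2_cases)

text \<open>The levels satisfy \<open>p < q\<close>, \<open>r < q\<close>, \<open>r < s\<close>, and
  the middle three points give a descending pair. If \<open>q < s\<close>, the triangle
  \<open>p, q, s\<close> yields two ascending colors. If \<open>s < q\<close>, the graph clause for
  \<open>r, s, q, p\<close> separates two descending or two ascending colors.\<close>

lemma three_list_colors_zigzag_four:
  assumes adm: "admissible 2 A \<phi>" and u: "ultra xs" and len: "length xs = 5"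
    and sub: "set (levels xs) \<subseteq> A"
    and z: "zigzag (levels xs)" and up: "levels xs ! 0 < levels xs ! 1"
  shows "3 \<le> card (list_colors 2 \<phi> xs)"
proof -
  obtain a b c d e where xs: "xs = [a, b, c, d, e]"
    using len by (auto simp: numeral_eq_Suc length_Suc_conv)
  define p q r s where "p = split_level a b" "q = split_level b c" "r = split_level c d" "s = split_level d e"
  note pqrs = this
  have lev: "levels xs = [p, q, r, s]"
    by (simp add: xs pqrs)
  have ord: "p < q" "r < q" "r < s"
    using up z[unfolded zigzag_def, rule_format, of 0] z[unfolded zigzag_def, rule_format, of 1]
    by (auto simp: lev)
  have A: "p \<in> A" "q \<in> A" "r \<in> A" "s \<in> A"
    using sub by (auto simp: lev)
  have ult: "split_level x z = max (split_level x y) (split_level y z)" "split_level x y \<noteq> split_level y z"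
    if "subseq [x, y, z] xs" for x y z
    using u that by (auto simp: ultra_def)
  have bd: "split_level b d = q"
    using ult[of b c d] ord by (simp add: xs pqrs)
  have ce: "split_level c e = s"
    using ult[of c d e] ord by (simp add: xs pqrs)
  have be: "split_level b e = max q s"
    using ult[of b d e] bd ord by (simp add: xs pqrs)
  have qs: "q \<noteq> s"
    using ult[of b d e] bd by (simp add: xs pqrs)
  have I: "(order_type 2 (levels ys), \<phi> (set (levels ys))) \<in> list_colors 2 \<phi> xs"
    if "subseq ys xs" "length ys = 3" for ys
    using list_colorsI[of ys xs 2 \<phi>] that by simp
  have desc: "({(1, 0)}, \<phi> {q, r}) \<in> list_colors 2 \<phi> xs"
    using I[of "[b, c, d]"] ord by (simp add: xs pqrs[symmetric] order_type_2)
  show ?thesis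
  proof (cases "q < s")
    case True
    have "{p, q, s} \<in> nsets A (2 + 1)"
      using ord True A by (auto simp: nsets_def)
    then have "2 \<le> card (\<phi> ` nsets {p, q, s} 2)"
      using adm unfolding admissible_def by blast
    moreover have "nsets {p, q, s} 2 = {{p, q}, {q, s}, {p, s}}"
      using ord True by (auto simp: nsets_2_eq)
    ultimately have "2 \<le> card {\<phi> {p, q}, \<phi> {q, s}, \<phi> {p, s}}"
      by (simp only: image_insert image_empty)
    then have "\<not> (\<phi> {p, q} = \<phi> {p, s} \<and> \<phi> {q, s} = \<phi> {p, s})"
      by (intro notI) simp
    moreover have "split_level a c = q"
      using ult[of a b c] ord by (simp add: xs pqrs)
    then have h: "({(0, 1)}, \<phi> {p, q}) \<in> list_colors 2 \<phi> xs" "({(0, 1)}, \<phi> {q, s}) \<in> list_colors 2 \<phi> xs"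
      "({(0, 1)}, \<phi> {p, s}) \<in> list_colors 2 \<phi> xs"
      using I[of "[a, b, c]"] I[of "[b, d, e]"] I[of "[a, b, e]"] ord True bd be
      by (simp_all add: xs pqrs[symmetric] order_type_2)
    ultimately show ?thesis
      using three_le_cardI[OF finite_list_colors desc h(1) h(3)]
        three_le_cardI[OF finite_list_colors desc h(2) h(3)] by auto
  next
    case False
    then have sq: "s < q"
      using qs by simp
    have "\<not> (\<phi> {r, q} = \<phi> {s, q} \<and> \<phi> {r, s} = \<phi> {p, q})"
      using adm ord A sq unfolding admissible_def by blast
    moreover have g: "({(1, 0)}, \<phi> {q, s}) \<in> list_colors 2 \<phi> xs"
      using I[of "[b, d, e]"] bd sq by (simp add: xs pqrs[symmetric] order_type_2)
    moreover have h: "({(0, 1)}, \<phi> {r, s}) \<in> list_colors 2 \<phi> xs" "({(0, 1)}, \<phi> {p, q}) \<in> list_colors 2 \<phi> xs"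
      using I[of "[c, d, e]"] I[of "[a, b, c]"] ord by (simp_all add: xs pqrs[symmetric] order_type_2)
    ultimately show ?thesis
      using three_le_cardI[OF finite_list_colors desc h(1) h(2)]
        three_le_cardI[OF finite_list_colors desc g h(1)] by (auto simp: insert_commute)
  qed
qed

text \<open>The cases are the coincidences among the types \<open>W 0\<close>, \<open>W 1\<close>,
  \<open>W 2\<close> of the three windows. Reversal turns increasing runs into decreasing ones and
  moves a maximum from the right end to the left.\<close>

lemma three_list_colors:
  assumes adm: "admissible k A \<phi>" and u: "ultra xs" and k: "k \<ge> 2" and len: "length xs = k + 3"
    and sub: "set (levels xs) \<subseteq> A"
  shows "3 \<le> card (list_colors k \<phi> xs)"
proof -
  define ds where "ds = levels xs"
  have lds: "length ds = k + 2"
    using len by (simp add: ds_def)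
  have neq: "ds ! i \<noteq> ds ! Suc i" if "i < k + 1" for i
    using ultra_levels_neq[OF u, of i] that len by (simp add: ds_def)
  have u': "ultra (rev xs)" "length (rev xs) = k + 3" "set (levels (rev xs)) \<subseteq> A"
    using u len sub by (auto simp: ultra_rev levels_rev)
  have mono: ?thesis if "sorted_wrt (>) (take (k + 1) ds) \<or> sorted_wrt (<) (take (k + 1) ds)
      \<or> sorted_wrt (>) (drop 1 ds) \<or> sorted_wrt (<) (drop 1 ds)"
  proof -
    have "take (k + 1) (rev ds) = rev (drop 1 ds)" "drop 1 (rev ds) = rev (take (k + 1) ds)"
      using lds by (simp_all add: take_rev drop_rev)
    then show ?thesis
      using that three_list_colors_decreasing_window[OF adm u k len sub]
        three_list_colors_decreasing_window[OF adm u'(1) k u'(2,3)]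
      by (auto simp: ds_def levels_rev card_list_colors_rev sorted_wrt_greater_rev)
  qed
  define W where "W = (\<lambda>m. order_type k (take k (drop m ds)))"
  have W: "\<exists>c. (W m, c) \<in> list_colors k \<phi> xs" if "m \<le> 2" for m
    using list_colors_window[of m k xs] len that by (simp add: W_def ds_def)
  obtain c0 c1 c2 where c: "(W 0, c0) \<in> list_colors k \<phi> xs" "(W 1, c1) \<in> list_colors k \<phi> xs"
    "(W 2, c2) \<in> list_colors k \<phi> xs"
    using W[of 0] W[of 1] W[of 2] by auto
  show ?thesis
  proof (cases "W 0 = W 1 \<or> W 1 = W 2")
    case True
    then show ?thesis
    proof
      assume "W 0 = W 1"
      then have "sorted_wrt (>) (take (k + 1) ds) \<or> sorted_wrt (<) (take (k + 1) ds)"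
        using lds neq by (intro monotone_if_windows_eq) (auto simp: W_def drop_take)
      then show ?thesis
        using mono by blast
    next
      assume "W 1 = W 2"
      then have "sorted_wrt (>) (drop 1 ds) \<or> sorted_wrt (<) (drop 1 ds)"
        using lds neq by (intro monotone_if_windows_eq) (auto simp: W_def numeral_2_eq_2)
      then show ?thesis
        using mono by blast
    qed
  next
    case False
    show ?thesis
    proof (cases "W 0 = W 2")
      case W02: True
      have shift: "ds ! i < ds ! j \<longleftrightarrow> ds ! (i + 2) < ds ! (j + 2)" if "i < k" "j < k" for i j
        using W02 mem_order_type_window[of 0 k ds i j] mem_order_type_window[of 2 k ds i j] that lds
        by (simp add: W_def)
      show ?thesis
      proof (cases "zigzag ds")
        case z: True
        have zr: "zigzag (levels (rev xs))"
          using zigzag_rev[OF z] by (simp add: levels_rev ds_def)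
        show ?thesis
        proof (cases "k = 2")
          case True
          \<comment> \<open>Of the three alternating steps the first and the last go the same way,
            so the sequence begins with an ascent when read from one of its ends.\<close>
          have "ds ! 0 < ds ! 1 \<or> rev ds ! 0 < rev ds ! 1"
            using z[unfolded zigzag_def, rule_format, of 0] z[unfolded zigzag_def, rule_format, of 1] lds True
            by (auto simp: rev_nth numeral_eq_Suc)
          then show ?thesis
            using three_list_colors_zigzag_four[of A \<phi> xs] three_list_colors_zigzag_four[of A \<phi> "rev xs"]
              adm u u' len sub z zr True
            by (auto simp: ds_def card_list_colors_rev levels_rev)
        next
          case False
          then have k3: "k \<ge> 3"
            using k by simp
          have "Max (set ds) \<in> set ds"
            using lds by (intro Max_in) auto
          then obtain m where m: "m < k + 2" "ds ! m = Max (set ds)"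
            using lds by (auto simp: in_set_conv_nth)
          have max: "ds ! i \<le> ds ! m" if "i < k + 2" for i
            using that lds m by simp
          \<comment> \<open>Otherwise the agreement of the outer windows makes level \<open>m - 2\<close> maximal as well, but equal
            levels are separated by a larger one.\<close>
          have "m \<le> 1 \<or> k \<le> m"
          proof (rule ccontr)
            assume "\<not> (m \<le> 1 \<or> k \<le> m)"
            then have mm: "2 \<le> m" "m < k"
              by auto
            define i where "i = m - 2"
            have i: "m = Suc (Suc i)"
              using mm by (simp add: i_def)
            have eq: "ds ! i = ds ! m"
              using shift[of i m] max[of "m + 2"] max[of i] mm i by auto
            have lt: "ds ! Suc i < ds ! i"
              using max[of "Suc i"] neq[of i] eq mm i by simp
            have "subseq [xs ! i, xs ! m, xs ! Suc m] xs"
            proof -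
              have "drop i xs = xs ! i # xs ! Suc i # drop m xs" "drop m xs = xs ! m # xs ! Suc m # drop (Suc (Suc m)) xs"
                using mm i len by (simp_all add: Cons_nth_drop_Suc)
              then have "subseq [xs ! i, xs ! m, xs ! Suc m] (drop i xs)"
                by simp
              then show ?thesis
                using subseq_drop subseq_order.trans by blast
            qed
            then have "split_level (xs ! i) (xs ! m) \<noteq> split_level (xs ! m) (xs ! Suc m)"
              using u by (simp add: ultra_def)
            then show False
              using ultra_split_level_two[OF u, of i] lt eq mm i len nth_levels[of m xs] by (simp add: ds_def)
          qed
          then show ?thesis
          proof
            assume "m \<le> 1"
            then show ?thesis
              using three_list_colors_zigzag_max[OF u k3 len] z max by (simp add: ds_def)
          next
            assume mk: "k \<le> m"
            \<comment> \<open>Reversal moves position \<open>m\<close> of the \<open>k + 2\<close>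
              levels to \<open>k + 1 - m\<close>, which is at most 1.\<close>
            have "levels (rev xs) ! i \<le> levels (rev xs) ! (k + 1 - m)" if "i < k + 2" for i
              using max[of "k + 1 - i"] that m(1) lds by (simp add: levels_rev ds_def[symmetric] rev_nth)
            then show ?thesis
              using three_list_colors_zigzag_max[OF u'(1) k3 u'(2) zr, of "k + 1 - m"] mk
              by (simp add: card_list_colors_rev)
          qed
        qed
      next
        case notz: False
        \<comment> \<open>Directions repeat with period two. So the first two steps decide: if they
          differ the sequence alternates, and if they agree it is monotone.\<close>
        have step: "ds ! i < ds ! Suc i \<longleftrightarrow> ds ! Suc (Suc i) < ds ! Suc (Suc (Suc i))" if "Suc i < k" for i
          using shift[of i "Suc i"] that by simp
        have eq01: "ds ! 0 < ds ! 1 \<longleftrightarrow> ds ! 1 < ds ! 2"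
        proof (rule ccontr)
          assume alt: "\<not> ?thesis"
          have "(ds ! i < ds ! Suc i) \<noteq> (ds ! Suc i < ds ! Suc (Suc i))" if "i < k" for i
            using that
          proof (induction i)
            case 0
            then show ?case using alt by (simp add: numeral_2_eq_2)
          next
            case (Suc i)
            then show ?case using step[of i] by auto
          qed
          moreover have "ds ! Suc i \<noteq> ds ! i" "ds ! Suc (Suc i) \<noteq> ds ! Suc i" if "i < k" for i
            using neq[of i] neq[of "Suc i"] that by auto
          ultimately have "zigzag ds"
            unfolding zigzag_def using lds by (metis add_2_eq_Suc' not_less_eq linorder_neqE_nat Suc_less_SucD)
          then show False
            using notz by simp
        qed
        have both: "(ds ! i < ds ! Suc i \<longleftrightarrow> ds ! 0 < ds ! 1) \<and> (ds ! Suc i < ds ! Suc (Suc i) \<longleftrightarrow> ds ! 0 < ds ! 1)" if "i < k" for i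
          using that
        proof (induction i)
          case 0
          then show ?case using eq01 by (simp add: numeral_2_eq_2)
        next
          case (Suc i)
          then show ?case using step[of i] by auto
        qed
        \<comment> \<open>The last step, \<open>i = k\<close>, is reached only as the second half of
          \<open>both\<close> at \<open>k - 1\<close>.\<close>
        have eqs: "ds ! i < ds ! Suc i \<longleftrightarrow> ds ! 0 < ds ! 1" if "i < k + 1" for i
          using both[of i] both[of "i - 1"] that k by (cases i) auto
        have "sorted_wrt (>) (take (k + 1) ds) \<or> sorted_wrt (<) (take (k + 1) ds)"
        proof (cases "ds ! 0 < ds ! 1")
          case True
          then have "ds ! i < ds ! Suc i" if "i < k + 1" for i
            using eqs[OF that] by simp
          then show ?thesis
            by (simp add: sorted_wrt_less_iff)
        next
          case False
          then have "ds ! Suc i < ds ! i" if "i < k + 1" for i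
            using eqs[OF that] neq[OF that] by simp
          then show ?thesis
            by (simp add: sorted_wrt_greater_iff)
        qed
        then show ?thesis
          using mono by blast
      qed
    next
      case W02: False
      then show ?thesis
        using False three_le_cardI[OF finite_list_colors c] by simp
    qed
  qed
qed

subsection \<open>The step from graphs to hypergraphs of higher uniformity\<close>

text \<open>The bound is asked of all sets, not only of edges, so that every
  \<open>list_color\<close> lies in one fixed finite set.\<close>

definition colorable :: "nat \<Rightarrow> nat \<Rightarrow> nat \<Rightarrow> bool" where
  "colorable k N r \<longleftrightarrow> (\<exists>\<phi>. (\<forall>e. \<phi> e < r) \<and> admissible k {..<N} \<phi>)"

section \<open>Splitting levels of binary numbers\<close>

lemma split_level_less_iff:
  assumes "x \<noteq> y"
  shows "split_level x y < i \<longleftrightarrow> x div 2 ^ i = y div 2 ^ i"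
proof -
  define l where "l = (LEAST i. x div 2 ^ i = y div 2 ^ i)"
  \<comment> \<open>Shifting by \<open>max x y\<close> clears both numbers, so the least exponent
    exists.\<close>
  have "max x y < 2 ^ max x y"
    by (rule less_exp)
  then have "x div 2 ^ max x y = y div 2 ^ max x y"
    by (simp only: max_less_iff_conj div_less)
  then have l: "x div 2 ^ l = y div 2 ^ l"
    unfolding l_def by (rule LeastI)
  have up: "x div 2 ^ j = y div 2 ^ j" if "l \<le> j" for j
  proof -
    have "(2::nat) ^ j = 2 ^ l * 2 ^ (j - l)"
      using that by (simp flip: power_add)
    then show ?thesis
      using l by (simp add: div_mult2_eq)
  qed
  have "l \<noteq> 0"
    using l assms by (intro notI) simp
  moreover have "l \<le> i \<longleftrightarrow> x div 2 ^ i = y div 2 ^ i"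
    using up Least_le[of "\<lambda>i. x div 2 ^ i = y div 2 ^ i" i] by (auto simp: l_def)
  ultimately show ?thesis
    by (auto simp: split_level_def l_def[symmetric])
qed

lemma split_level_bound: "x \<noteq> y \<Longrightarrow> x < 2 ^ N \<Longrightarrow> y < 2 ^ N \<Longrightarrow> split_level x y < N"
  by (simp add: split_level_less_iff)

text \<open>Shifting is monotone, so \<open>x\<close> and \<open>z\<close> agree after a shift iff
  \<open>y\<close> agrees with both. The two sides thus have the same strict upper bounds.\<close>

lemma split_level_max:
  assumes "x < y" "y < z"
  shows "split_level x z = max (split_level x y) (split_level y z)"
proof -
  have "split_level x z < i \<longleftrightarrow> max (split_level x y) (split_level y z) < i" for i
    using assms div_le_mono[of x y "2 ^ i"] div_le_mono[of y z "2 ^ i"]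
    by (simp add: split_level_less_iff) linarith
  from this[of "split_level x z"] this[of "max (split_level x y) (split_level y z)"]
  show ?thesis
    by (simp only: less_irrefl simp_thms not_less)
qed

text \<open>At a common level \<open>s\<close> the shifts by \<open>s\<close> would be three
  different numbers with the same half, but only two numbers share a half.\<close>

lemma split_level_neq:
  assumes "x < y" "y < z"
  shows "split_level x y \<noteq> split_level y z"
proof
  assume eq: "split_level x y = split_level y z"
  define s where "s = split_level x y"
  have *: "u div 2 ^ Suc s = u div 2 ^ s div 2" for u :: nat
    by (simp only: power_Suc2 div_mult2_eq)
  have sp: "split_level x y = s" "split_level y z = s" "x \<noteq> y" "y \<noteq> z"
    using eq assms by (auto simp: s_def)
  have "x div 2 ^ s \<noteq> y div 2 ^ s" "y div 2 ^ s \<noteq> z div 2 ^ s"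
    using split_level_less_iff[OF sp(3), of s] split_level_less_iff[OF sp(4), of s] unfolding sp(1,2) by simp_all
  moreover have "x div 2 ^ Suc s = y div 2 ^ Suc s" "y div 2 ^ Suc s = z div 2 ^ Suc s"
    using split_level_less_iff[OF sp(3), of "Suc s"] split_level_less_iff[OF sp(4), of "Suc s"]
    unfolding sp(1,2) by simp_all
  then have "x div 2 ^ s div 2 = y div 2 ^ s div 2" "y div 2 ^ s div 2 = z div 2 ^ s div 2"
    by (simp_all only: *)
  moreover have "x div 2 ^ s \<le> y div 2 ^ s" "y div 2 ^ s \<le> z div 2 ^ s"
    using assms by (simp_all add: div_le_mono)
  moreover have "\<not> (p \<noteq> q \<and> q \<noteq> r \<and> p div 2 = q div 2 \<and> q div 2 = r div 2 \<and> p \<le> q \<and> q \<le> r)"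
    for p q r :: nat
    by linarith
  note this[of "x div 2 ^ s" "y div 2 ^ s" "z div 2 ^ s"]
  ultimately show False
    by simp
qed

lemma subseq_set_subset: "subseq ys xs \<Longrightarrow> set ys \<subseteq> set xs"
  by (induction rule: list_emb.induct) auto

lemma sorted_wrt_subseq: "subseq ys xs \<Longrightarrow> sorted_wrt P xs \<Longrightarrow> sorted_wrt P ys"
  by (induction rule: list_emb.induct) (use subseq_set_subset in fastforce)+

lemma ultra_sorted: "sorted_wrt (<) xs \<Longrightarrow> ultra xs"
  unfolding ultra_def
  by (auto dest!: sorted_wrt_subseq[of "[_, _, _]"] simp: split_level_max split_level_neq)

lemma levels_subset:
  assumes "sorted_wrt (<) xs" "set xs \<subseteq> {..<2 ^ N}"
  shows "set (levels xs) \<subseteq> {..<N}"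
  using assms
  by (induction xs rule: induct_list012) (auto intro!: split_level_bound)

text \<open>An edge gets the \<open>list_color\<close> of its increasing enumeration, coded as a
  number. The graph clause is void in uniformity \<open>Suc k \<ge> 3\<close>.\<close>

lemma colorable_step:
  assumes k: "k \<ge> 2" and col: "colorable k N r"
  shows "colorable (Suc k) (2 ^ N) (2 ^ (k * k) * r)"
proof -
  obtain \<phi> where \<phi>: "\<And>e. \<phi> e < r" "admissible k {..<N} \<phi>"
    using col by (auto simp: colorable_def)
  define F where "F = Pow ({..<k} \<times> {..<k}) \<times> {..<r}"
  have F: "finite F" "card F = 2 ^ (k * k) * r"
    by (simp_all add: F_def card_cartesian_product card_Pow)
  obtain h where h: "bij_betw h F {0..<card F}"
    using ex_bij_betw_finite_nat[OF F(1)] by blast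
  have inF: "list_color k \<phi> xs \<in> F" for xs
    using \<phi>(1) by (auto simp: list_color_def F_def order_type_def)
  define \<phi>' where "\<phi>' = (\<lambda>e. h (list_color k \<phi> (sorted_list_of_set e)))"
  \<comment> \<open>A sublist of length \<open>k + 1\<close> of the enumeration of \<open>S\<close>
    is the enumeration of an edge inside \<open>S\<close>, and the injective \<open>h\<close> keeps
    colors distinct.\<close>
  have card: "card (list_colors k \<phi> (sorted_list_of_set S)) \<le> card (\<phi>' ` nsets S (Suc k))" if "finite S" for S :: "nat set"
  proof -
    have "h ` list_colors k \<phi> (sorted_list_of_set S) \<subseteq> \<phi>' ` nsets S (Suc k)"
    proof (clarsimp simp: list_colors_def)
      fix ys assume ys: "subseq ys (sorted_list_of_set S)" "length ys = Suc k"
      have sub: "set ys \<subseteq> S"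
        using subseq_set_subset[OF ys(1)] that by simp
      have srt: "sorted_wrt (<) ys"
        by (rule sorted_wrt_subseq[OF ys(1)]) simp
      have "sorted_list_of_set (set ys) = ys"
        by (rule sorted_list_of_set.idem_if_sorted_distinct) (use srt strict_sorted_iff in auto)
      moreover have "set ys \<in> nsets S (Suc k)"
        using sub ys(2) srt by (simp add: nsets_def strict_sorted_iff distinct_card)
      ultimately show "h (list_color k \<phi> ys) \<in> \<phi>' ` nsets S (Suc k)"
        by (intro image_eqI[of _ _ "set ys"]) (simp_all add: \<phi>'_def)
    qed
    moreover have "inj_on h (list_colors k \<phi> (sorted_list_of_set S))"
      by (rule inj_on_subset[OF bij_betw_imp_inj_on[OF h]]) (auto simp: list_colors_def inF)
    ultimately show ?thesis
      using card_mono[of "\<phi>' ` nsets S (Suc k)" "h ` list_colors k \<phi> (sorted_list_of_set S)"] that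
      by (simp add: card_image finite_imp_finite_nsets)
  qed
  have lists: "ultra (sorted_list_of_set S)" "length (sorted_list_of_set S) = card S"
    "set (levels (sorted_list_of_set S)) \<subseteq> {..<N}" if "S \<subseteq> {..<2 ^ N}" for S :: "nat set"
  proof -
    have "sorted_wrt (<) (sorted_list_of_set S)" "set (sorted_list_of_set S) \<subseteq> {..<2 ^ N}"
      using that finite_subset[OF that] by simp_all
    then show "ultra (sorted_list_of_set S)" "set (levels (sorted_list_of_set S)) \<subseteq> {..<N}"
      using ultra_sorted levels_subset by blast+
  qed simp
  have "admissible (Suc k) {..<2 ^ N} \<phi>'"
    unfolding admissible_def
  proof (intro conjI ballI impI)
    fix S :: "nat set" assume "S \<in> nsets {..<2 ^ N} (Suc k + 1)"
    then have "S \<subseteq> {..<2 ^ N}" "finite S" "card S = k + 2"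
      by (auto simp: nsets_def)
    then have "2 \<le> card (list_colors k \<phi> (sorted_list_of_set S))"
      using k by (intro two_list_colors[OF \<phi>(2)] lists) (simp_all add: lists)
    then show "2 \<le> card (\<phi>' ` nsets S (Suc k))"
      using card[OF \<open>finite S\<close>] by simp
  next
    fix S :: "nat set" assume "S \<in> nsets {..<2 ^ N} (Suc k + 2)"
    then have "S \<subseteq> {..<2 ^ N}" "finite S" "card S = k + 3"
      by (auto simp: nsets_def)
    then have "3 \<le> card (list_colors k \<phi> (sorted_list_of_set S))"
      using k by (intro three_list_colors[OF \<phi>(2)] lists) (simp_all add: lists)
    then show "3 \<le> card (\<phi>' ` nsets S (Suc k))"
      using card[OF \<open>finite S\<close>] by simp
  qed (use k in auto)
  moreover have "\<phi>' e < 2 ^ (k * k) * r" for e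
    using bij_betwE[OF h] inF F(2) by (auto simp: \<phi>'_def)
  ultimately show ?thesis
    by (auto simp: colorable_def)
qed

lemma admissible_subset:
  assumes "admissible k A \<phi>" "B \<subseteq> A"
  shows "admissible k B \<phi>"
proof -
  have "D \<in> nsets A p" if "D \<in> nsets B p" for D p
    using that nsets_mono[OF assms(2)] by blast
  moreover have "x \<in> A" if "x \<in> B" for x
    using that assms(2) by blast
  ultimately show ?thesis
    using assms(1) by (simp add: admissible_def)
qed

lemma colorable_mono: "colorable k N r \<Longrightarrow> n \<le> N \<Longrightarrow> colorable k n r"
  unfolding colorable_def by (meson admissible_subset lessThan_subset_iff)

subsection \<open>The graph coloring\<close>

text \<open>Numbers below \<open>m ^ t\<close> stand for the words of length \<open>t\<close> over
  \<open>m\<close> letters, position 0 being the lowest digit.\<close>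

definition digit :: "nat \<Rightarrow> nat \<Rightarrow> nat \<Rightarrow> nat" where
  "digit m x j = x div m ^ j mod m"

lemma digits_eq_imp_mod_eq:
  "(\<And>j. j < t \<Longrightarrow> digit m x j = digit m y j) \<Longrightarrow> x mod m ^ t = y mod m ^ t"
proof (induction t)
  case (Suc t)
  have "x mod m ^ t = y mod m ^ t" "x div m ^ t mod m = y div m ^ t mod m"
    using Suc.IH Suc.prems Suc.prems[of t] by (auto simp: digit_def)
  then show ?case
    by (simp only: power_Suc2 mod_mult2_eq)
qed simp

text \<open>First means lowest, so this need not be the digit that decides the numerical order of
  \<open>x\<close> and \<open>y\<close>.\<close>

definition first_diff :: "nat \<Rightarrow> nat \<Rightarrow> nat \<Rightarrow> nat" where
  "first_diff m x y = (LEAST j. digit m x j \<noteq> digit m y j)"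

definition edge_code :: "nat \<Rightarrow> nat \<Rightarrow> nat \<Rightarrow> nat \<Rightarrow> nat \<times> nat \<times> nat \<times> nat set" where
  "edge_code m t x y = (first_diff m x y, digit m x (first_diff m x y), digit m y (first_diff m x y),
     {j. j < t \<and> digit m x j \<noteq> digit m y j})"

lemma first_diff:
  assumes "x \<noteq> y" "x < m ^ t" "y < m ^ t"
  shows "first_diff m x y < t" "digit m x (first_diff m x y) \<noteq> digit m y (first_diff m x y)"
    "j < first_diff m x y \<Longrightarrow> digit m x j = digit m y j"
proof -
  obtain j where j: "j < t" "digit m x j \<noteq> digit m y j"
    using digits_eq_imp_mod_eq[of t m x y] assms by auto
  show "digit m x (first_diff m x y) \<noteq> digit m y (first_diff m x y)"
    unfolding first_diff_def using j(2) by (rule LeastI)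
  show "first_diff m x y < t"
    using j Least_le[of "\<lambda>j. digit m x j \<noteq> digit m y j" j] by (simp add: first_diff_def)
  show "j < first_diff m x y \<Longrightarrow> digit m x j = digit m y j" for j
    using not_less_Least[of j "\<lambda>j. digit m x j \<noteq> digit m y j"] by (auto simp: first_diff_def)
qed

lemma edge_code_eqD:
  assumes "edge_code m t x y = edge_code m t x' y'"
  shows "first_diff m x y = first_diff m x' y'"
    "digit m x (first_diff m x y) = digit m x' (first_diff m x' y')"
    "digit m y (first_diff m x y) = digit m y' (first_diff m x' y')"
    "j < t \<Longrightarrow> digit m x j = digit m y j \<longleftrightarrow> digit m x' j = digit m y' j"
proof -
  show "first_diff m x y = first_diff m x' y'"
    "digit m x (first_diff m x y) = digit m x' (first_diff m x' y')"
    "digit m y (first_diff m x y) = digit m y' (first_diff m x' y')"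
    using assms unfolding edge_code_def prod.inject by blast+
  have "{j. j < t \<and> digit m x j \<noteq> digit m y j} = {j. j < t \<and> digit m x' j \<noteq> digit m y' j}"
    using assms unfolding edge_code_def prod.inject by blast+
  then show "digit m x j = digit m y j \<longleftrightarrow> digit m x' j = digit m y' j" if "j < t"
    using that by blast
qed

text \<open>Equal codes share the first position and the letter of the second end there, so
  \<open>y\<close> and \<open>z\<close> would agree where they first differ.\<close>

lemma edge_code_path:
  assumes "y \<noteq> z" "y < m ^ t" "z < m ^ t"
  shows "edge_code m t x y \<noteq> edge_code m t y z"
proof
  assume "edge_code m t x y = edge_code m t y z"
  note eq = edge_code_eqD[OF this]
  show False
    using first_diff(2)[OF assms] eq(2,3) by (simp add: eq(1))
qed

text \<open>Where \<open>a\<close> and \<open>b\<close> first differ, \<open>c\<close> has the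
  letter of \<open>a\<close> and \<open>d\<close> that of \<open>b\<close>. So \<open>b\<close>
  differs there from \<open>c\<close> but not from \<open>d\<close>, and the sets of differing
  positions disagree.\<close>

lemma edge_code_matching_fork:
  assumes "a \<noteq> b" "a < m ^ t" "b < m ^ t" "edge_code m t a b = edge_code m t c d"
  shows "edge_code m t b c \<noteq> edge_code m t b d"
proof
  assume eq: "edge_code m t b c = edge_code m t b d"
  define i where "i = first_diff m a b"
  have i: "digit m a i = digit m c i" "digit m b i = digit m d i"
    using edge_code_eqD(1-3)[OF assms(4)] by (simp_all only: i_def)
  have "i < t" "digit m a i \<noteq> digit m b i"
    using first_diff(1,2)[OF assms(1-3)] by (simp_all only: i_def not_False_eq_True)
  then show False
    using edge_code_eqD(4)[OF eq, of i] i by simp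
qed

text \<open>Where \<open>a\<close> and \<open>b\<close> first differ, \<open>c\<close> has the
  letter of \<open>b\<close>, so this position belongs to the difference set of \<open>a, c\<close>
  but not to that of \<open>b, c\<close>. This gives the graph clause of
  \<open>admissible\<close>.\<close>

lemma edge_code_matching_join:
  assumes "a \<noteq> b" "a < m ^ t" "b < m ^ t" "edge_code m t a b = edge_code m t d c"
  shows "edge_code m t a c \<noteq> edge_code m t b c"
proof
  assume eq: "edge_code m t a c = edge_code m t b c"
  define i where "i = first_diff m a b"
  have i: "digit m b i = digit m c i"
    using edge_code_eqD(1,3)[OF assms(4)] by (simp only: i_def)
  have "i < t" "digit m a i \<noteq> digit m b i"
    using first_diff(1,2)[OF assms(1-3)] by (simp_all only: i_def not_False_eq_True)
  then show False
    using edge_code_eqD(4)[OF eq, of i] i by simp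
qed

lemma colorable_2: "colorable 2 (2 ^ (t * t)) (2 ^ (4 * t))"
proof (cases "t = 0")
  case True
  have "admissible 2 {..<1} (\<lambda>e. 0)"
    by (auto simp: admissible_def nsets_eq_empty)
  then show ?thesis
    using True by (auto simp: colorable_def)
next
  case False
  define m :: nat where "m = 2 ^ t"
  have mt: "m ^ t = 2 ^ (t * t)"
    by (simp add: m_def power_mult)
  define F where "F = {..<t} \<times> {..<m} \<times> {..<m} \<times> Pow {..<t}"
  have F: "finite F"
    by (simp add: F_def)
  have "card F = t * (2 ^ t * (2 ^ t * 2 ^ t))"
    by (simp add: F_def card_cartesian_product card_Pow m_def)
  \<comment> \<open>The crude bound \<open>2 ^ t\<close> on the number \<open>t\<close> of first
    positions gives the exponent \<open>4 * t\<close>.\<close>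
  also have "\<dots> \<le> 2 ^ t * (2 ^ t * (2 ^ t * 2 ^ t))"
    using less_exp[of t] by simp
  also have "\<dots> = 2 ^ (4 * t)"
    by (simp flip: power_add)
  finally have cF: "card F \<le> 2 ^ (4 * t)" .
  obtain h where h: "bij_betw h F {0..<card F}"
    using ex_bij_betw_finite_nat[OF F] by blast
  define code where "code = (\<lambda>e. edge_code m t (Min e) (Max e))"
  \<comment> \<open>The default 0 keeps the bound on sets whose code is not in
    \<open>F\<close>.\<close>
  define \<phi> where "\<phi> = (\<lambda>e. if code e \<in> F then h (code e) else 0)"
  have "\<phi> e < 2 ^ (4 * t)" for e
    using bij_betwE[OF h] cF by (fastforce simp: \<phi>_def)
  moreover have "admissible 2 {..<2 ^ (t * t)} \<phi>"
  proof -
    have inF: "edge_code m t x y \<in> F" if "x < y" "y < m ^ t" for x y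
      using first_diff(1)[of x y m t] that by (auto simp: edge_code_def F_def digit_def m_def)
    have \<phi>: "\<phi> {x, y} = h (edge_code m t x y)" if "x < y" "y < m ^ t" for x y
      using inF[OF that] that by (simp add: \<phi>_def code_def)
    have eq: "\<phi> {x, y} = \<phi> {x', y'} \<longleftrightarrow> edge_code m t x y = edge_code m t x' y'"
      if "x < y" "y < m ^ t" "x' < y'" "y' < m ^ t" for x y x' y'
      using that inF bij_betw_imp_inj_on[OF h] by (auto simp: \<phi> inj_on_def)
    have path: "\<phi> {x, y} \<noteq> \<phi> {y, z}" if "x < y" "y < z" "z < m ^ t" for x y z
      using edge_code_path[of y z m t x] that eq by auto
    have mem: "\<phi> {x, y} \<in> \<phi> ` nsets D 2" if "x \<in> D" "y \<in> D" "x < y" for x y D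
      using that by (intro imageI) auto
    have fin: "finite (\<phi> ` nsets D 2)" if "finite D" for D
      using that by (simp add: finite_imp_finite_nsets)
    have "2 \<le> card (\<phi> ` nsets D 2)" if D: "D \<in> nsets {..<m ^ t} (2 + 1)" for D
    proof -
      obtain a b c where abc: "D = {a, b, c}" "a < b" "b < c" "c < m ^ t"
        using D ordered_nsets_3_eq[of "{..<m ^ t}"] by auto
      then show ?thesis
        using two_le_cardI[OF fin mem[of a D b] mem[of b D c]] path[of a b c] by simp
    qed
    moreover have "3 \<le> card (\<phi> ` nsets D 2)" if D: "D \<in> nsets {..<m ^ t} (2 + 2)" for D
    proof -
      obtain a b c d where abcd: "D = {a, b, c, d}" "a < b" "b < c" "c < d" "d < m ^ t"
        using D ordered_nsets_4_eq[of "{..<m ^ t}"] by auto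
      have ne: "\<phi> {a, b} \<noteq> \<phi> {b, c}" "\<phi> {a, b} \<noteq> \<phi> {b, d}" "\<phi> {b, c} \<noteq> \<phi> {c, d}"
        using path[of a b c] path[of a b d] path[of b c d] abcd by auto
      \<comment> \<open>The color of \<open>ab\<close> differs from those of \<open>bc\<close> and
        \<open>bd\<close>. Either these two differ from each other, or the fork argument separates
        \<open>ab\<close> from \<open>cd\<close>.\<close>
      show ?thesis
      proof (cases "\<phi> {b, c} = \<phi> {b, d}")
        case True
        then have "\<phi> {a, b} \<noteq> \<phi> {c, d}"
          using edge_code_matching_fork[of a b m t c d] eq abcd by auto
        then show ?thesis
          using three_le_cardI[OF fin mem[of a D b] mem[of b D c] mem[of c D d]] ne abcd by simp
      next
        case False
        then show ?thesis
          using three_le_cardI[OF fin mem[of a D b] mem[of b D c] mem[of b D d]] ne abcd by simp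
      qed
    qed
    moreover have "\<not> (\<phi> {a, c} = \<phi> {b, c} \<and> \<phi> {a, b} = \<phi> {d, c})"
      if "a < b" "b < c" "d < c" "c < m ^ t" for a b c d
      using edge_code_matching_join[of a b m t d c] eq[of a b d c] eq[of a c b c] that by auto
    ultimately show ?thesis
      unfolding admissible_def mt[symmetric] by blast
  qed
  ultimately show ?thesis
    by (auto simp: colorable_def)
qed

subsection \<open>Asymptotics\<close>

lemma f_EG_le:
  assumes "colorable k n r"
  shows "f_EG k n (k + 2) 3 \<le> r"
proof -
  obtain \<phi> where "\<And>e. \<phi> e < r" "admissible k {..<n} \<phi>"
    using assms by (auto simp: colorable_def)
  then have "pq_coloring k n (k + 2) 3 \<phi> \<and> \<phi> ` nsets {..<n} k \<subseteq> {..<r}"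
    by (auto simp: pq_coloring_def admissible_def)
  then show ?thesis
    unfolding f_EG_def by (intro Least_le) blast
qed

text \<open>Makes the logarithm of the number of colors nonnegative. The minimum is attained because
  \<open>3 \<le> (k + 2) choose k\<close>.\<close>

lemma f_EG_pos:
  assumes "k \<ge> 1" "n \<ge> k + 2"
  shows "f_EG k n (k + 2) 3 \<ge> 1"
proof -
  have "3 * 2 \<le> (k + 2) * (k + 1)"
    using assms(1) by (intro mult_mono) auto
  then have "3 \<le> (k + 2) choose k"
    using binomial_symmetric[of 2 "k + 2"] by (simp add: choose_two)
  from LeastI_ex[OF ex_pq_coloring[OF this, of n]]
  obtain c where c: "pq_coloring k n (k + 2) 3 c" "c ` nsets {..<n} k \<subseteq> {..<f_EG k n (k + 2) 3}"
    unfolding f_EG_def by blast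
  have "{..<k + 2} \<in> nsets {..<n} (k + 2)"
    using assms(2) by (auto simp: nsets_def)
  then have "3 \<le> card (c ` nsets {..<k + 2} k)"
    using c(1) unfolding pq_coloring_def by blast
  then have "nsets {..<k + 2} k \<noteq> {}"
    by (intro notI) simp
  then have "c ` nsets {..<n} k \<noteq> {}"
    using nsets_mono[of "{..<k + 2}" "{..<n}" k] assms(2) by auto
  then show ?thesis
    using c(2) by (cases "f_EG k n (k + 2) 3") auto
qed

section \<open>Iterated logarithms and the size of the colorings\<close>

lemma iter_ln_Suc: "iter_ln (Suc i) x = ln (iter_ln i x)"
  by (simp add: iter_ln_def)

lemma iter_ln_ln: "iter_ln i (ln x) = iter_ln (Suc i) x"
  by (simp add: iter_ln_def funpow_swap1)

lemma filterlim_iter_ln: "filterlim g at_top F \<Longrightarrow> filterlim (\<lambda>n. iter_ln i (g n)) at_top F"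
proof (induction i)
  case 0
  then show ?case by (simp add: iter_ln_def)
next
  case (Suc i)
  then show ?case
    unfolding iter_ln_Suc using filterlim_compose[OF ln_at_top] by blast
qed

text \<open>The factor 2 survives each logarithm: \<open>ln (2 * h) = ln 2 + ln h\<close> is at most
  \<open>2 * ln h\<close> once \<open>h \<ge> 2\<close>.\<close>

lemma iter_ln_le_twice:
  assumes "\<forall>\<^sub>F n in F. g n \<le> 2 * h n" "filterlim g at_top F" "filterlim h at_top F"
  shows "\<forall>\<^sub>F n in F. iter_ln i (g n) \<le> 2 * iter_ln i (h n)"
proof (induction i)
  case 0
  then show ?case using assms(1) by (simp add: iter_ln_def)
next
  case (Suc i)
  have "\<forall>\<^sub>F n in F. 1 \<le> iter_ln i (g n)"
    using filterlim_iter_ln[OF assms(2)] by (simp add: filterlim_at_top)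
  moreover have "\<forall>\<^sub>F n in F. 2 \<le> iter_ln i (h n)"
    using filterlim_iter_ln[OF assms(3)] by (simp add: filterlim_at_top)
  ultimately show ?case
    using Suc
  proof eventually_elim
    case (elim n)
    have "ln (iter_ln i (g n)) \<le> ln (2 * iter_ln i (h n))"
      using elim by (subst ln_le_cancel_iff) auto
    also have "\<dots> = ln 2 + ln (iter_ln i (h n))"
      using elim by (simp add: ln_mult)
    also have "ln 2 \<le> ln (iter_ln i (h n))"
      using elim by simp
    finally show ?case
      by (simp add: iter_ln_Suc)
  qed
qed

text \<open>The word length is the root of \<open>log 2 n\<close>, rounded up. Rounding at most
  doubles it, which turns the 4 of \<open>4 * t\<close> into 8, and \<open>ln 2 \<le> 1\<close>
  absorbs the change of base.\<close>

lemma colorable_2_bound: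
  assumes n: "n \<ge> 2"
  shows "\<exists>r. colorable 2 n r \<and> real r \<le> exp (8 * sqrt (ln (real n)))"
proof -
  define L where "L = log 2 (real n)"
  define t where "t = nat \<lceil>sqrt L\<rceil>"
  have L: "L \<ge> 1"
    using n by (simp add: L_def)
  have "sqrt L \<le> real t"
    using L by (simp add: t_def)
  then have "(sqrt L)\<^sup>2 \<le> (real t)\<^sup>2"
    using L by (intro power_mono) auto
  then have "L \<le> real (t * t)"
    using L by (simp add: power2_eq_square)
  then have "2 powr L \<le> 2 powr real (t * t)"
    by simp
  then have "real n \<le> real (2 ^ (t * t))"
    using n by (simp only: L_def powr_realpow of_nat_power of_nat_numeral) simp
  then have "n \<le> 2 ^ (t * t)"
    by (simp only: of_nat_le_iff)
  then have "colorable 2 n (2 ^ (4 * t))"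
    using colorable_2 colorable_mono by blast
  moreover have "real (2 ^ (4 * t)) \<le> exp (8 * sqrt (ln (real n)))"
  proof -
    have "1 \<le> sqrt L"
      using L by simp
    then have "real t \<le> 2 * sqrt L"
      unfolding t_def by linarith
    moreover have "sqrt L * ln 2 \<le> sqrt (ln (real n))"
    proof (rule real_le_rsqrt)
      have "(sqrt L * ln 2)\<^sup>2 = L * ln 2 * ln 2"
        using L by (simp add: power_mult_distrib power2_eq_square)
      also have "\<dots> = ln (real n) * ln 2"
        by (simp add: L_def log_def)
      also have "\<dots> \<le> ln (real n) * 1"
        using n ln_le_minus_one[of 2] by (intro mult_left_mono) auto
      finally show "(sqrt L * ln 2)\<^sup>2 \<le> ln (real n)"
        by simp
    qed
    moreover have "real t * ln 2 \<le> 2 * sqrt L * ln 2"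
      using \<open>real t \<le> 2 * sqrt L\<close> by (intro mult_right_mono) auto
    ultimately have "4 * real t * ln 2 \<le> 8 * sqrt (ln (real n))"
      by linarith
    moreover have "real (2 ^ (4 * t)) = exp (4 * real t * ln 2)"
      by (simp add: powr_realpow[symmetric] powr_def)
    ultimately show ?thesis
      by simp
  qed
  ultimately show ?thesis
    by blast
qed

text \<open>A step passes from \<open>n\<close> to about \<open>log 2 n\<close> and so uses up one
  logarithm. In the new constant \<open>2 * \<bar>C\<bar> + 1\<close> the factor 2 pays for this
  passage and the summand 1 for the factor \<open>2 ^ (k * k)\<close>.\<close>

lemma colorable_bound:
  assumes "k \<ge> 2"
  shows "\<exists>C. \<forall>\<^sub>F n in sequentially. \<exists>r. colorable k n r \<and> real r \<le> exp (C * sqrt (iter_ln (k - 1) (real n)))"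
  using assms
proof (induction k rule: nat_induct_at_least)
  case base
  have "\<forall>\<^sub>F n in sequentially. \<exists>r. colorable 2 n r \<and> real r \<le> exp (8 * sqrt (iter_ln (2 - 1) (real n)))"
    using colorable_2_bound by (intro eventually_sequentiallyI[of 2]) (simp add: iter_ln_def)
  then show ?case by blast
next
  case (Suc k)
  then obtain C where C: "\<forall>\<^sub>F n in sequentially. \<exists>r. colorable k n r \<and> real r \<le> exp (C * sqrt (iter_ln (k - 1) (real n)))"
    by blast
  define N where "N = (\<lambda>n::nat. nat \<lceil>log 2 (real n)\<rceil>)"
  have N: "filterlim N at_top sequentially"
    unfolding N_def by real_asymp
  have limln: "filterlim (\<lambda>n. ln (real n)) at_top sequentially"
    by real_asymp
  then have "\<forall>\<^sub>F n in sequentially. 2 \<le> ln (real n)"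
    by (simp add: filterlim_at_top)
  then have N2: "\<forall>\<^sub>F n in sequentially. real (N n) \<le> 2 * ln (real n)"
    using eventually_ge_at_top[of 1]
  proof eventually_elim
    case (elim n)
    \<comment> \<open>As \<open>ln 2 \<ge> 2 / 3\<close>, base 2 costs a factor
      \<open>3 / 2\<close>; rounding up adds at most 1, hence at most half of \<open>ln n\<close>,
      which is at least 2.\<close>
    have "ln (real n) * 1 \<le> ln (real n) * (3 / 2 * ln 2)"
      using elim ln2_ge_two_thirds by (intro mult_left_mono) auto
    then have "log 2 (real n) \<le> 3 / 2 * ln (real n)"
      by (simp add: log_def divide_simps)
    moreover have "0 \<le> log 2 (real n)"
      using elim by simp
    ultimately show ?case
      using elim unfolding N_def by linarith
  qed
  have limN: "filterlim (\<lambda>n. real (N n)) at_top sequentially"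
    using N filterlim_compose[OF filterlim_real_sequentially] by blast
  have "\<forall>\<^sub>F n in sequentially. iter_ln (k - 1) (real (N n)) \<le> 2 * iter_ln (k - 1) (ln (real n))"
    by (rule iter_ln_le_twice[OF N2 limN limln])
  moreover have "\<forall>\<^sub>F n in sequentially. 0 \<le> iter_ln (k - 1) (real (N n))"
    using filterlim_iter_ln[OF limN] by (simp add: filterlim_at_top)
  \<comment> \<open>For such \<open>n\<close> the factor \<open>2 ^ (k * k)\<close> is at most
    \<open>exp (sqrt y)\<close>.\<close>
  moreover have "\<forall>\<^sub>F n in sequentially. (real (k * k))\<^sup>2 \<le> iter_ln (k - 1) (ln (real n))"
    using filterlim_iter_ln[OF limln] by (simp only: filterlim_at_top)
  moreover have "\<forall>\<^sub>F n in sequentially. \<exists>r. colorable k (N n) r \<and> real r \<le> exp (C * sqrt (iter_ln (k - 1) (real (N n))))"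
    using C N by (rule eventually_compose_filterlim)
  ultimately have "\<forall>\<^sub>F n in sequentially. \<exists>r. colorable (Suc k) n r \<and>
      real r \<le> exp ((2 * \<bar>C\<bar> + 1) * sqrt (iter_ln (Suc k - 1) (real n)))"
    using eventually_ge_at_top[of 1]
  proof eventually_elim
    case (elim n)
    define y where "y = iter_ln k (real n)"
    define x where "x = iter_ln (k - 1) (real (N n))"
    have y: "iter_ln (k - 1) (ln (real n)) = y"
      using Suc.hyps by (simp add: y_def iter_ln_ln)
    obtain r where r: "colorable k (N n) r" "real r \<le> exp (C * sqrt x)"
      using elim by (auto simp: x_def)
    have "real n = 2 powr log 2 (real n)"
      using elim by simp
    also have "\<dots> \<le> 2 powr real (N n)"
      by (intro powr_mono) (simp_all add: N_def real_nat_ceiling_ge)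
    also have "\<dots> = real (2 ^ N n)"
      by (simp add: powr_realpow)
    finally have "n \<le> 2 ^ N n"
      by (simp only: of_nat_le_iff)
    then have col: "colorable (Suc k) n (2 ^ (k * k) * r)"
      using colorable_step[OF _ r(1)] Suc.hyps colorable_mono by blast
    have "0 \<le> x" "x \<le> 2 * y"
      using elim y by (simp_all add: x_def)
    \<comment> \<open>Weakening 2 to the square 4 lets it leave the root.\<close>
    then have "sqrt x \<le> sqrt (4 * y)" "0 \<le> sqrt x" "0 \<le> y"
      by simp_all
    then have sx: "sqrt x \<le> 2 * sqrt y"
      by (simp add: real_sqrt_mult)
    have ky: "real (k * k) \<le> sqrt y"
      using elim by (intro real_le_rsqrt) (simp only: y)
    have "C * sqrt x \<le> \<bar>C\<bar> * (2 * sqrt y)"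
      using sx \<open>0 \<le> sqrt x\<close> by (intro mult_mono) auto
    then have "real r \<le> exp (\<bar>C\<bar> * (2 * sqrt y))"
      using r(2) by (meson exp_le_cancel_iff order_trans)
    moreover have "(2::real) ^ (k * k) \<le> exp (sqrt y)"
    proof -
      have "(2::real) ^ (k * k) \<le> exp 1 ^ (k * k)"
        using exp_ge_add_one_self[of 1] by (intro power_mono) auto
      also have "\<dots> = exp (real (k * k))"
        by (simp flip: exp_of_nat_mult)
      also have "\<dots> \<le> exp (sqrt y)"
        using ky by simp
      finally show ?thesis .
    qed
    ultimately have "2 ^ (k * k) * real r \<le> exp (sqrt y) * exp (\<bar>C\<bar> * (2 * sqrt y))"
      by (intro mult_mono) auto
    also have "\<dots> = exp ((2 * \<bar>C\<bar> + 1) * sqrt y)"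
      by (simp add: exp_add[symmetric] algebra_simps)
    finally show ?case
      using col by (intro exI[of _ "2 ^ (k * k) * r"]) (simp add: y_def)
  qed
  then show ?case
    by blast
qed

text \<open>Once \<open>L n \<ge> 1\<close>, the quotient is at most \<open>C / sqrt (L n)\<close>
  in absolute value.\<close>

lemma smallo_quotient:
  fixes g L :: "nat \<Rightarrow> real"
  assumes g: "\<forall>\<^sub>F n in sequentially. \<bar>g n\<bar> \<le> C * sqrt (L n)" and L: "filterlim L at_top sequentially"
  shows "(\<lambda>n. g n / L n) \<in> o[sequentially](\<lambda>_. 1 :: real)"
proof (rule smalloI_tendsto)
  have "((\<lambda>x. C * sqrt x / x) \<longlongrightarrow> 0) at_top"
    by real_asymp
  then have lim: "(\<lambda>n. C * sqrt (L n) / L n) \<longlonglongrightarrow> 0"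
    using filterlim_compose[OF _ L] by blast
  have "\<forall>\<^sub>F n in sequentially. L n \<ge> 1"
    using L by (simp add: filterlim_at_top)
  with g have "\<forall>\<^sub>F n in sequentially. norm (g n / L n) \<le> C * sqrt (L n) / L n"
    by eventually_elim (simp add: divide_right_mono)
  then have "(\<lambda>n. g n / L n) \<longlonglongrightarrow> 0"
    by (rule Lim_null_comparison[OF _ lim])
  then show "(\<lambda>n. g n / L n / 1) \<longlonglongrightarrow> 0"
    by simp
qed simp

theorem theorem1p2:
  fixes k :: nat
  assumes "k \<ge> 4"
  shows "(\<exists>C::real. \<forall>\<^sub>F n in sequentially.
            real (f_EG k n (k + 2) 3) \<le> exp (C * sqrt (iter_ln (k - 1) (real n))))
       \<and> (\<forall>C::real. \<exists>\<epsilon> \<in> o[sequentially](\<lambda>_. 1 :: real). \<forall>\<^sub>F n in sequentially.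
            exp (C * sqrt (iter_ln (k - 1) (real n))) = iter_ln (k - 2) (real n) powr \<epsilon> n)
       \<and> (\<exists>\<epsilon> \<in> o[sequentially](\<lambda>_. 1 :: real). \<forall>\<^sub>F n in sequentially.
            real (f_EG k n (k + 2) 3) = iter_ln (k - 2) (real n) powr \<epsilon> n)"
proof -
  define L where "L = (\<lambda>n::nat. iter_ln (k - 1) (real n))"
  have L: "filterlim L at_top sequentially"
    unfolding L_def by (intro filterlim_iter_ln filterlim_real_sequentially)
  have "k - 1 = Suc (k - 2)"
    using assms by simp
  then have LM: "ln (iter_ln (k - 2) (real n)) = L n" for n
    by (simp only: L_def iter_ln_Suc)
  have "filterlim (\<lambda>n. iter_ln (k - 2) (real n)) at_top sequentially"
    by (intro filterlim_iter_ln filterlim_real_sequentially)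
  then have M: "\<forall>\<^sub>F n in sequentially. 1 \<le> iter_ln (k - 2) (real n)"
    by (simp only: filterlim_at_top)
  have L1: "\<forall>\<^sub>F n in sequentially. 1 \<le> L n"
    using L by (simp only: filterlim_at_top)
  \<comment> \<open>\<open>L n\<close> is the logarithm of the base, so dividing \<open>g n\<close>
    by it gives the exponent to that base.\<close>
  have powr: "\<forall>\<^sub>F n in sequentially. exp (g n) = iter_ln (k - 2) (real n) powr (g n / L n)" for g
    using M L1 by eventually_elim (simp add: powr_def LM)
  obtain C where C: "\<forall>\<^sub>F n in sequentially. \<exists>r. colorable k n r \<and> real r \<le> exp (C * sqrt (L n))"
    using colorable_bound[of k] assms by (auto simp: L_def)
  have upper: "\<forall>\<^sub>F n in sequentially. real (f_EG k n (k + 2) 3) \<le> exp (C * sqrt (L n))"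
    using C by eventually_elim (meson f_EG_le of_nat_le_iff order_trans)
  \<comment> \<open>With this the logarithm of the number of colors is nonnegative, so the upper
    bound also controls its absolute value.\<close>
  have lower: "\<forall>\<^sub>F n in sequentially. 1 \<le> real (f_EG k n (k + 2) 3)"
    using f_EG_pos[of k] assms by (intro eventually_sequentiallyI[of "k + 2"]) simp
  have "\<exists>\<epsilon> \<in> o[sequentially](\<lambda>_. 1 :: real). \<forall>\<^sub>F n in sequentially.
      exp (D * sqrt (L n)) = iter_ln (k - 2) (real n) powr \<epsilon> n" for D
  proof -
    have "\<forall>\<^sub>F n in sequentially. \<bar>D * sqrt (L n)\<bar> \<le> \<bar>D\<bar> * sqrt (L n)"
      using L1 by eventually_elim (simp add: abs_mult)
    then show ?thesis
      by (intro bexI[of _ "\<lambda>n. D * sqrt (L n) / L n"] smallo_quotient[OF _ L] powr)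
  qed
  moreover have "\<exists>\<epsilon> \<in> o[sequentially](\<lambda>_. 1 :: real). \<forall>\<^sub>F n in sequentially.
      real (f_EG k n (k + 2) 3) = iter_ln (k - 2) (real n) powr \<epsilon> n"
  proof -
    define g where "g = (\<lambda>n. ln (real (f_EG k n (k + 2) 3)))"
    have "\<forall>\<^sub>F n in sequentially. \<bar>g n\<bar> \<le> C * sqrt (L n)"
      using upper lower
    proof eventually_elim
      case (elim n)
      then have "ln (real (f_EG k n (k + 2) 3)) \<le> ln (exp (C * sqrt (L n)))"
        by (subst ln_le_cancel_iff) auto
      then show ?case
        using elim by (simp add: g_def)
    qed
    then have "(\<lambda>n. g n / L n) \<in> o[sequentially](\<lambda>_. 1 :: real)"
      by (rule smallo_quotient[OF _ L])
    moreover have "\<forall>\<^sub>F n in sequentially. real (f_EG k n (k + 2) 3) = iter_ln (k - 2) (real n) powr (g n / L n)"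
      using powr[of g] lower by eventually_elim (simp add: g_def)
    ultimately show ?thesis
      by (intro bexI[of _ "\<lambda>n. g n / L n"])
  qed
  ultimately show ?thesis
    using upper unfolding L_def by blast
qed

end
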